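(* Let $X$ be a $W$-hyperbolic space, $C\subseteq X$ a convex subset, $T:C\to C$ a nonexpansive mapping with a fixed point $p$, and $u,x_0\in C$. Assume that $\lambda\in(0,1]$, $\lambda_n=\lambda$ for all $n\in\mathbb N$, $\beta_0\in[0,1]$, $\beta_1=0$ and $\beta_n=1-\frac2n$ for $n\ge2$, and let $(x_n)$ be the Tikhonov-Mann iteration starting with $x_0$ for these scalars. Let $K\ge1$ be an integer with $K\ge\max\{d(x_0,p),d(u,p)\}$. Then for all $n\ge1$, $$d(x_{n+1},x_n)\le\frac{4K}{n},\qquad d(x_n,Tx_n)\le\frac{8K}{\lambda n}.$$
   Context: A $W$-space is a metric space $(X,d)$ with a function $W:X\times X\times[0,1]\to X$; one writes $(1-\lambda)x+\lambda y$ for $W(x,y,\lambda)$. It is a $W$-hyperbolic space if for all $x,y,z,w\in X$ and $\lambda,\tilde\lambda\in[0,1]$: (W1) $d(z,(1-\lambda)x+\lambda y)\le(1-\lambda)d(z,x)+\lambda d(z,y)$; (W2) $d((1-\lambda)x+\lambda y,(1-\tilde\lambda)x+\tilde\lambda y)=|\lambda-\tilde\lambda|\,d(x,y)$; (W3) $(1-\lambda)x+\lambda y=\lambda y+(1-\lambda)x$, i.e. $W(x,y,\lambda)=W(y,x,1-\lambda)$; (W4) $d((1-\lambda)x+\lambda z,(1-\lambda)y+\lambda w)\le(1-\lambda)d(x,y)+\lambda d(z,w)$. A nonempty $C\subseteq X$ is convex if $(1-\lambda)x+\lambda y\in C$ for all $x,y\in C$, $\lambda\in[0,1]$. $T$ is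 nonexpansive if $d(Tx,Ty)\le d(x,y)$ for all $x,y\in C$. Tikhonov-Mann iteration: for $n\in\mathbb N$, $x_{n+1}=(1-\lambda_n)u_n+\lambda_nTu_n$ with $u_n=(1-\beta_n)u+\beta_nx_n$. *)

theory Defs
  imports "HOL-Analysis.Analysis"
begin

(* W x y l stands for (1 - l) x + l y: the weight l belongs to the second point.
   Values of W outside X, or for weights outside [0,1], are unconstrained. *)
locale W_space = Metric_space X d
  for X :: "'a set" and d :: "'a \<Rightarrow> 'a \<Rightarrow> real" +
  fixes W :: "'a \<Rightarrow> 'a \<Rightarrow> real \<Rightarrow> 'a"
  assumes W_closed: "\<lbrakk>x \<in> X; y \<in> X; l \<in> {0..1}\<rbrakk> \<Longrightarrow> W x y l \<in> X"

locale W_hyperbolic_space = W_space X d W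
  for X :: "'a set" and d :: "'a \<Rightarrow> 'a \<Rightarrow> real" and W :: "'a \<Rightarrow> 'a \<Rightarrow> real \<Rightarrow> 'a" +
  assumes W1: "\<lbrakk>x \<in> X; y \<in> X; z \<in> X; l \<in> {0..1}\<rbrakk>
      \<Longrightarrow> d z (W x y l) \<le> (1 - l) * d z x + l * d z y"
    and W2: "\<lbrakk>x \<in> X; y \<in> X; l \<in> {0..1}; l' \<in> {0..1}\<rbrakk>
      \<Longrightarrow> d (W x y l) (W x y l') = \<bar>l - l'\<bar> * d x y"
    and W3: "\<lbrakk>x \<in> X; y \<in> X; l \<in> {0..1}\<rbrakk> \<Longrightarrow> W x y l = W y x (1 - l)"
    and W4: "\<lbrakk>x \<in> X; y \<in> X; z \<in> X; w \<in> X; l \<in> {0..1}\<rbrakk>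
      \<Longrightarrow> d (W x z l) (W y w l) \<le> (1 - l) * d x y + l * d z w"

definition W_convex :: "'a set \<Rightarrow> ('a \<Rightarrow> 'a \<Rightarrow> real \<Rightarrow> 'a) \<Rightarrow> 'a set \<Rightarrow> bool" where
  "W_convex X W C \<longleftrightarrow>
     C \<noteq> {} \<and> C \<subseteq> X \<and> (\<forall>x\<in>C. \<forall>y\<in>C. \<forall>l\<in>{0..1}. W x y l \<in> C)"

definition nonexpansive_on :: "('a \<Rightarrow> 'a \<Rightarrow> real) \<Rightarrow> 'a set \<Rightarrow> ('a \<Rightarrow> 'a) \<Rightarrow> bool" where
  "nonexpansive_on d C T \<longleftrightarrow> (\<forall>x\<in>C. \<forall>y\<in>C. d (T x) (T y) \<le> d x y)"

primrec tikhonov_mann ::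
  "('a \<Rightarrow> 'a \<Rightarrow> real \<Rightarrow> 'a) \<Rightarrow> ('a \<Rightarrow> 'a) \<Rightarrow> 'a \<Rightarrow> (nat \<Rightarrow> real) \<Rightarrow> (nat \<Rightarrow> real) \<Rightarrow> 'a \<Rightarrow> nat \<Rightarrow> 'a"
where
  "tikhonov_mann W T u lam \<beta> x0 0 = x0"
| "tikhonov_mann W T u lam \<beta> x0 (Suc n) =
     (let u\<^sub>n = W u (tikhonov_mann W T u lam \<beta> x0 n) (\<beta> n) in W u\<^sub>n (T u\<^sub>n) (lam n))"

end

theory Submission
  imports Defs
begin

text \<open>The Krasnoselskii map \<open>S v = (1 - l) v + l T v\<close> is nonexpansive and \<open>d v (S v) = l d v (T v)\<close>;
  since the weights \<open>lam n\<close> are constant, \<open>x\<^sub>n\<^sub>+\<^sub>1 = S u\<^sub>n\<close>. As all \<open>x\<^sub>n\<close> stay within \<open>K\<close> of \<open>p\<close>,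
  the consecutive distances \<open>a n = d x\<^sub>n\<^sub>+\<^sub>1 x\<^sub>n\<close> satisfy
  \<open>a n \<le> \<beta> n * a (n - 1) + 2 K \<bar>\<beta> n - \<beta> (n - 1)\<bar>\<close>, and for \<open>\<beta> n = 1 - 2 / n\<close> the bound
  \<open>4 K / n\<close> is reproduced by this recursion. Finally
  \<open>l d x\<^sub>n (T x\<^sub>n) = d x\<^sub>n (S x\<^sub>n) \<le> a n + d u\<^sub>n x\<^sub>n\<close>, where
  \<open>d u\<^sub>n x\<^sub>n = (1 - \<beta> n) d u x\<^sub>n \<le> 4 K / n\<close>.\<close>

lemma W_convexD:
  assumes "W_convex X W C" and "x \<in> C" "y \<in> C" "l \<in> {0..1}"
  shows "W x y l \<in> C"
  using assms by (auto simp: W_convex_def)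

lemma tikhonov_mann_in:
  assumes "W_convex X W C" and "T \<in> C \<rightarrow> C" and "u \<in> C" and "x0 \<in> C"
    and "\<And>n. lam n \<in> {0..1}" and "\<And>n. \<beta> n \<in> {0..1}"
  shows "tikhonov_mann W T u lam \<beta> x0 n \<in> C"
proof (induction n)
  case 0
  show ?case using assms(4) by simp
next
  case (Suc n)
  let ?v = "W u (tikhonov_mann W T u lam \<beta> x0 n) (\<beta> n)"
  have "?v \<in> C" by (rule W_convexD[OF assms(1,3) Suc assms(6)])
  moreover from this assms(2) have "T ?v \<in> C" by blast
  ultimately have "W ?v (T ?v) (lam n) \<in> C"
    by (rule W_convexD[OF assms(1) _ _ assms(5)])
  then show ?case by (simp add: Let_def)
qed

context W_hyperbolic_space
begin

text \<open>Taking \<open>z = x\<close> in \<open>W1\<close> forces the distance from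
  \<open>x\<close> to vanish. With \<open>W2\<close> this yields the distances from
  \<open>W x y l\<close> to both end points.\<close>

lemma W_0:
  assumes "x \<in> X" "y \<in> X"
  shows "W x y 0 = x"
proof -
  have "W x y 0 \<in> X" by (rule W_closed) (use assms in auto)
  moreover have "d x (W x y 0) \<le> 0" using W1[of x y x 0] assms by simp
  ultimately show ?thesis using assms nonneg[of x "W x y 0"] by fastforce
qed

lemma dist_W_left:
  assumes "x \<in> X" "y \<in> X" "l \<in> {0..1}"
  shows "d x (W x y l) = l * d x y"
  using W2[of x y 0 l] W_0[of x y] assms by simp

lemma dist_W_right:
  assumes "x \<in> X" "y \<in> X" "l \<in> {0..1}"
  shows "d (W x y l) y = (1 - l) * d x y"
  using dist_W_left[of y x "1 - l"] W3[of x y l] assms by (simp add: commute)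

text \<open>Closed balls are convex: \<open>W1\<close> bounds the distance to the centre by an
  average of two numbers that are at most \<open>r\<close>.\<close>

lemma dist_W_le_radius:
  assumes "x \<in> X" "y \<in> X" "p \<in> X" "l \<in> {0..1}" "d x p \<le> r" "d y p \<le> r"
  shows "d (W x y l) p \<le> r"
proof -
  have "d (W x y l) p \<le> (1 - l) * d p x + l * d p y"
    using W1[of x y p l] assms by (simp add: commute)
  also have "\<dots> \<le> (1 - l) * r + l * r"
    using assms by (intro add_mono mult_left_mono) (auto simp: commute)
  finally show ?thesis by (simp add: algebra_simps)
qed

text \<open>Pass through \<open>W u y a\<close>: \<open>W4\<close> pays for replacing
  \<open>x\<close> by \<open>y\<close> at a fixed weight, \<open>W2\<close> for replacing the weight
  \<open>a\<close> by \<open>b\<close>.\<close>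

lemma dist_W_W_same_left:
  assumes "u \<in> X" "x \<in> X" "y \<in> X" "a \<in> {0..1}" "b \<in> {0..1}"
  shows "d (W u x a) (W u y b) \<le> a * d x y + \<bar>a - b\<bar> * d u y"
proof -
  have "d (W u x a) (W u y b) \<le> d (W u x a) (W u y a) + d (W u y a) (W u y b)"
    using assms by (intro triangle W_closed)
  moreover have "d (W u x a) (W u y a) \<le> a * d x y"
    using W4[of u u x y a] assms by simp
  ultimately show ?thesis using W2[of u y a b] assms by simp
qed

lemma Krasnoselskii_nonexpansive:
  assumes "nonexpansive_on d C T" "T \<in> C \<rightarrow> C" "C \<subseteq> X" "l \<in> {0..1}" "x \<in> C" "y \<in> C"
  shows "d (W x (T x) l) (W y (T y) l) \<le> d x y"
proof -
  have "T x \<in> C" "T y \<in> C" using assms by auto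
  then have "d (W x (T x) l) (W y (T y) l) \<le> (1 - l) * d x y + l * d (T x) (T y)"
    using assms by (intro W4) auto
  also have "\<dots> \<le> (1 - l) * d x y + l * d x y"
    using assms by (intro add_mono mult_left_mono) (auto simp: nonexpansive_on_def)
  finally show ?thesis by (simp add: algebra_simps)
qed

text \<open>The ball of radius \<open>r\<close> about \<open>p\<close> is preserved by each step: it
  is convex and contains \<open>u\<close>, and \<open>T\<close> does not increase the distance to
  its fixed point \<open>p\<close>.\<close>

lemma tikhonov_mann_dist_fixpoint:
  assumes C: "W_convex X W C" and T: "T \<in> C \<rightarrow> C" "nonexpansive_on d C T"
    and p: "p \<in> C" "T p = p" and u: "u \<in> C" "x0 \<in> C"
    and lam: "\<And>n. lam n \<in> {0..1}" and \<beta>: "\<And>n. \<beta> n \<in> {0..1}"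
    and r: "d x0 p \<le> r" "d u p \<le> r"
  shows "d (tikhonov_mann W T u lam \<beta> x0 n) p \<le> r"
proof (induction n)
  case 0
  show ?case using r by simp
next
  case (Suc n)
  let ?x = "tikhonov_mann W T u lam \<beta> x0 n"
  let ?v = "W u ?x (\<beta> n)"
  have sub: "C \<subseteq> X" using C by (simp add: W_convex_def)
  have xC: "?x \<in> C" using tikhonov_mann_in[OF C T(1) u lam \<beta>] .
  have vC: "?v \<in> C" using W_convexD[OF C u(1) xC \<beta>] .
  have vr: "d ?v p \<le> r" using sub u(1) xC p(1) \<beta> r(2) Suc by (intro dist_W_le_radius) auto
  have "d (T ?v) p \<le> d ?v p"
    using T(2) vC p by (metis nonexpansive_on_def)
  then have "d (W ?v (T ?v) (lam n)) p \<le> r"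
    using vr sub vC p(1) T(1) lam[of n] by (intro dist_W_le_radius[of ?v]) auto
  then show ?case by (simp add: Let_def)
qed

end

theorem proposition4p10:
  fixes X C :: "'a set"
    and d :: "'a \<Rightarrow> 'a \<Rightarrow> real"
    and W :: "'a \<Rightarrow> 'a \<Rightarrow> real \<Rightarrow> 'a"
    and T :: "'a \<Rightarrow> 'a"
    and p u x0 :: 'a
    and l :: real
    and lam \<beta> :: "nat \<Rightarrow> real"
    and x :: "nat \<Rightarrow> 'a"
    and K :: int
  assumes "W_hyperbolic_space X d W"
    and "W_convex X W C"
    and "T \<in> C \<rightarrow> C"
    and "nonexpansive_on d C T"
    and "p \<in> C" and "T p = p"
    and "u \<in> C" and "x0 \<in> C"
    and "l \<in> {0<..1}"
    and "\<And>n. lam n = l"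
    and "\<beta> 0 \<in> {0..1}"
    and "\<beta> 1 = 0"
    and "\<And>n. n \<ge> 2 \<Longrightarrow> \<beta> n = 1 - 2 / real n"
    and "x = tikhonov_mann W T u lam \<beta> x0"
    and "K \<ge> 1"
    and "real_of_int K \<ge> max (d x0 p) (d u p)"
  shows "\<forall>n\<ge>1. d (x (n + 1)) (x n) \<le> 4 * real_of_int K / real n
               \<and> d (x n) (T (x n)) \<le> 8 * real_of_int K / (l * real n)"
proof -
  interpret W_hyperbolic_space X d W by fact
  define k where "k = real_of_int K"
  have k: "k \<ge> 1" "d x0 p \<le> k" "d u p \<le> k"
    using assms(15,16) by (simp_all add: k_def)
  have sub: "C \<subseteq> X" using assms(2) by (simp add: W_convex_def)
  have l: "0 < l" "l \<le> 1" "l \<in> {0..1}" using assms(9) by auto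
  have lam01: "lam n \<in> {0..1}" for n using l assms(10) by simp
  have \<beta>01: "\<beta> n \<in> {0..1}" for n
  proof -
    consider "n = 0" | "n = 1" | "n \<ge> 2" by linarith
    then show ?thesis
      by cases (use assms(11,12) in \<open>simp_all add: assms(13)\<close>)
  qed
  define v where "v n = W u (x n) (\<beta> n)" for n
  define S where "S y = W y (T y) l" for y
  have xC: "x n \<in> C" for n
    unfolding assms(14) using assms(2,3,7,8) lam01 \<beta>01 by (rule tikhonov_mann_in)
  have vC: "v n \<in> C" for n
    unfolding v_def by (rule W_convexD[OF assms(2,7) xC \<beta>01])
  have xX: "x n \<in> X" and uX: "u \<in> X" and pX: "p \<in> X" for n
    using sub xC assms(5,7) by auto
  have TX: "T (x n) \<in> X" for n using sub xC assms(3) by blast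
  have xS: "x (Suc n) = S (v n)" for n
    by (simp add: assms(10,14) S_def v_def Let_def)
  have S: "d (S y) (S z) \<le> d y z" if "y \<in> C" "z \<in> C" for y z
    unfolding S_def using assms(4,3) sub l(3) that by (rule Krasnoselskii_nonexpansive)
  have xp: "d (x n) p \<le> k" for n
    unfolding assms(14)
    using assms(2-8) lam01 \<beta>01 k(2,3) by (rule tikhonov_mann_dist_fixpoint)
  \<comment> \<open>Both points lie within \<open>k\<close> of \<open>p\<close>; this is the source
    of the factor 2 in the recursion.\<close>
  have ux: "d u (x n) \<le> 2 * k" for n
    using triangle[OF uX pX xX, of n] xp[of n] k(3) commute[of p "x n"] by linarith
  have rec: "d (x (Suc (Suc n))) (x (Suc n))
      \<le> \<beta> (Suc n) * d (x (Suc n)) (x n) + \<bar>\<beta> (Suc n) - \<beta> n\<bar> * (2 * k)" for n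
  proof -
    have "d (x (Suc (Suc n))) (x (Suc n)) \<le> d (v (Suc n)) (v n)"
      using S[OF vC vC] by (simp add: xS)
    also have "\<dots> \<le> \<beta> (Suc n) * d (x (Suc n)) (x n) + \<bar>\<beta> (Suc n) - \<beta> n\<bar> * d u (x n)"
      unfolding v_def using uX xX \<beta>01 by (intro dist_W_W_same_left)
    also have "\<dots> \<le> \<beta> (Suc n) * d (x (Suc n)) (x n) + \<bar>\<beta> (Suc n) - \<beta> n\<bar> * (2 * k)"
      using ux[of n] by (intro add_left_mono mult_left_mono) auto
    finally show ?thesis .
  qed
  have \<beta>1: "\<beta> (Suc 0) = 0" using assms(12) by simp
  have step: "d (x (Suc n)) (x n) \<le> 4 * k / real n" if "n \<ge> 1" for n
    using that
  proof (induction n rule: nat_induct_at_least)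
    \<comment> \<open>Since \<open>\<beta> 1 = 0\<close>, the first distance drops out of the
      recursion, and the arbitrary \<open>\<beta> 0\<close> contributes at most
      \<open>2 * k\<close>.\<close>
    case base
    have "d (x (Suc (Suc 0))) (x (Suc 0)) \<le> \<bar>\<beta> 0\<bar> * (2 * k)"
      using rec[of 0] \<beta>1 by simp
    also have "\<dots> \<le> 1 * (2 * k)"
      using \<beta>01[of 0] k(1) by (intro mult_right_mono) auto
    finally show ?case using k(1) by simp
  next
    case (Suc n)
    show ?case
    \<comment> \<open>The formula \<open>1 - 2 / n\<close> does not give \<open>\<beta> 1\<close>,
      so the difference of weights computed below needs \<open>n \<ge> 2\<close>. For
      \<open>n = 1\<close> both \<open>\<beta> 1\<close> and \<open>\<beta> 2\<close> are 0, and the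
      recursion gives distance 0.\<close>
    proof (cases "n = 1")
      case True
      then show ?thesis using rec[of 1] \<beta>1 assms(13)[of 2] k(1) by (simp add: numeral_2_eq_2)
    next
      case False
      define m where "m = real n"
      from False Suc(1) have n: "n \<ge> 2" and m: "m \<ge> 2" by (auto simp: m_def)
      have b: "\<beta> n = 1 - 2 / m" "\<beta> (Suc n) = 1 - 2 / (m + 1)"
        using n assms(13)[of n] assms(13)[of "Suc n"] by (simp_all add: m_def add.commute)
      have diff: "\<bar>\<beta> (Suc n) - \<beta> n\<bar> = 2 / (m * (m + 1))"
      proof -
        have "\<beta> (Suc n) - \<beta> n = 2 / (m * (m + 1))"
          using m by (simp add: b field_simps)
        then show ?thesis using m by simp
      qed
      have "\<beta> (Suc n) * d (x (Suc n)) (x n) \<le> \<beta> (Suc n) * (4 * k / m)"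
        using Suc(2) \<beta>01[of "Suc n"] by (intro mult_left_mono) (auto simp: m_def)
      then have "d (x (Suc (Suc n))) (x (Suc n))
          \<le> (1 - 2 / (m + 1)) * (4 * k / m) + 2 / (m * (m + 1)) * (2 * k)"
        using rec[of n, unfolded diff] unfolding b(2) by linarith
      \<comment> \<open>The first summand is \<open>4 * k * (m - 1) / (m * (m + 1))\<close>, and the
        second, \<open>4 * k / (m * (m + 1))\<close>, supplies exactly the missing unit in
        \<open>m - 1\<close>.\<close>
      also have "\<dots> = 4 * k / (m + 1)"
        using m by (simp add: divide_simps) (simp add: algebra_simps)
      finally show ?thesis by (simp add: m_def add.commute)
    qed
  qed
  have resid: "d (x n) (T (x n)) \<le> 8 * k / (l * real n)" if n: "n \<ge> 1" for n
  proof -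
    \<comment> \<open>Equality holds for \<open>n \<ge> 2\<close>; at \<open>n = 1\<close> it reads
      \<open>1 \<le> 2\<close>.\<close>
    have "1 - \<beta> n \<le> 2 / real n"
      using n \<beta>1 assms(13)[of n] by (cases "n = 1") auto
    then have "(1 - \<beta> n) * d u (x n) \<le> 2 / real n * (2 * k)"
      using ux[of n] by (intro mult_mono) auto
    then have vx: "d (v n) (x n) \<le> 4 * k / real n"
      unfolding v_def by (subst dist_W_right[OF uX xX \<beta>01]) simp
    have SX: "S y \<in> X" if "y \<in> C" for y
      unfolding S_def using that sub assms(3) l(3) by (intro W_closed) auto
    have "l * d (x n) (T (x n)) = d (x n) (S (x n))"
      unfolding S_def by (rule dist_W_left[OF xX TX l(3), symmetric])
    also have "\<dots> \<le> d (x n) (x (Suc n)) + d (x (Suc n)) (S (x n))"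
      by (rule triangle[OF xX xX SX[OF xC]])
    also have "d (x (Suc n)) (S (x n)) \<le> d (v n) (x n)"
      unfolding xS by (rule S[OF vC xC])
    finally have "l * d (x n) (T (x n)) \<le> 8 * k / real n"
      using step[OF n] vx by (simp add: commute)
    then show ?thesis using l(1) n by (simp add: field_simps)
  qed
  show ?thesis using step resid by (simp add: k_def)
qed

end
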